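(* For every integer $n\ge 1$, the complex number $c_n$ is an integer, i.e. $c_n\in\mathbb{Z}$.
   Context: Fibonacci numbers: $F_1=F_2=1$, $F_{n+1}=F_n+F_{n-1}$. For an integer $n\ge 0$, $s_F(n)$ is the number of terms in the Zeckendorf representation of $n$ (the unique representation of $n$ as a sum of distinct, pairwise non-consecutive Fibonacci numbers $F_i$, $i\ge2$), with $s_F(0)=0$. Let $\sigma=(1+\sqrt{-3})/2$ and $\overline\sigma$ its complex conjugate. The sequence $(c_n)_{n\ge1}$ is defined by $$c_{n+1}=\sum_{k=0}^n\sigma^{s_F(k)}\,\overline\sigma^{\,s_F(n-k)}\quad(n\ge 0).$$ *)

theory Defs
  imports Complex_Main "HOL-Number_Theory.Fib"
begin

definition is_zeckendorf :: "nat set \<Rightarrow> nat \<Rightarrow> bool" where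
  "is_zeckendorf S n \<longleftrightarrow>
     finite S \<and> (\<forall>i\<in>S. 2 \<le> i) \<and> (\<forall>i\<in>S. Suc i \<notin> S) \<and> (\<Sum>i\<in>S. fib i) = n"

lemma sum_fib_less:
  assumes "finite S" "\<forall>i\<in>S. 2 \<le> i \<and> i \<le> m" "\<forall>i\<in>S. Suc i \<notin> S"
  shows "(\<Sum>i\<in>S. fib i) < fib (Suc m)"
  using assms
proof (induction m arbitrary: S rule: less_induct)
  case (less m)
  show ?case
  proof (cases "m \<in> S")
    case False
    show ?thesis
    proof (cases m)
      case 0
      then have "S = {}" using less.prems(2) by fastforce
      then show ?thesis by (simp add: 0)
    next
      case (Suc k)
      have "\<forall>i\<in>S. 2 \<le> i \<and> i \<le> k"
        using less.prems(2) False Suc by (metis le_SucE)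
      then have "(\<Sum>i\<in>S. fib i) < fib (Suc k)"
        using less.IH[of k S] less.prems Suc by auto
      also have "\<dots> \<le> fib (Suc m)" using Suc by (intro fib_mono) auto
      finally show ?thesis .
    qed
  next
    case True
    then obtain k where k: "m = Suc (Suc k)"
      using less.prems(2) by (metis add_2_eq_Suc le_Suc_ex)
    let ?T = "S - {m}"
    have "\<forall>i\<in>?T. 2 \<le> i \<and> i \<le> k"
    proof
      fix i assume i: "i \<in> ?T"
      have "i \<noteq> Suc k" using less.prems(3) True i k by auto
      then show "2 \<le> i \<and> i \<le> k" using less.prems(2) i k
        by (metis DiffE insertI1 le_SucE)
    qed
    then have "(\<Sum>i\<in>?T. fib i) < fib (Suc k)"
      using less.IH[of k ?T] less.prems k by auto
    moreover have "(\<Sum>i\<in>S. fib i) = fib m + (\<Sum>i\<in>?T. fib i)"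
      using True less.prems(1) by (rule sum.remove[rotated])
    ultimately show ?thesis using k by simp
  qed
qed

lemma zeckendorf_Max:
  assumes "is_zeckendorf S n" "S \<noteq> {}"
  shows "fib (Max S) \<le> n" "n < fib (Suc (Max S))"
proof -
  have *: "finite S" "\<forall>i\<in>S. 2 \<le> i \<and> i \<le> Max S" "\<forall>i\<in>S. Suc i \<notin> S"
    and n: "(\<Sum>i\<in>S. fib i) = n"
    using assms by (auto simp: is_zeckendorf_def)
  show "n < fib (Suc (Max S))" using sum_fib_less[OF *] n by simp
  show "fib (Max S) \<le> n" using member_le_sum[of "Max S" S fib] *(1) assms(2) n by auto
qed

lemma zeckendorf_remove:
  assumes "is_zeckendorf S n" "m \<in> S"
  shows "is_zeckendorf (S - {m}) (n - fib m)"
  using assms sum.remove[of S m fib] by (auto simp: is_zeckendorf_def)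

lemma zeckendorf_unique:
  assumes "is_zeckendorf S n" "is_zeckendorf T n"
  shows "S = T"
  using assms
proof (induction n arbitrary: S T rule: less_induct)
  case (less n)
  have pos: "0 < n" if "is_zeckendorf S n" "S \<noteq> {}" for S
  proof -
    have "Max S \<in> S" using that by (auto simp: is_zeckendorf_def)
    then have "0 < fib (Max S)" using that(1) by (intro fib_neq_0_nat) (fastforce simp: is_zeckendorf_def)
    then show ?thesis using zeckendorf_Max(1)[OF that] by linarith
  qed
  show ?case
  proof (cases "n = 0")
    case True
    then show ?thesis using pos less.prems by blast
  next
    case False
    then have ne: "S \<noteq> {}" "T \<noteq> {}" using less.prems by (auto simp: is_zeckendorf_def)
    have le: "Max A \<le> Max B"
      if A: "is_zeckendorf A n" "A \<noteq> {}" and B: "is_zeckendorf B n" "B \<noteq> {}" for A B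
    proof (rule ccontr)
      assume "\<not> Max A \<le> Max B"
      then have "fib (Suc (Max B)) \<le> fib (Max A)" by (intro fib_mono) simp
      then show False using zeckendorf_Max(1)[OF A] zeckendorf_Max(2)[OF B] by linarith
    qed
    have eq: "Max S = Max T" using le less.prems ne by (meson le_antisym)
    let ?m = "Max S"
    have fin: "finite S" "finite T" using less.prems by (simp_all add: is_zeckendorf_def)
    have mem: "?m \<in> S" "?m \<in> T"
      using Max_in[OF fin(1) ne(1)] Max_in[OF fin(2) ne(2)] eq by simp_all
    have "0 < fib ?m" using mem less.prems by (intro fib_neq_0_nat) (fastforce simp: is_zeckendorf_def)
    then have "S - {?m} = T - {?m}"
      using less.IH[of "n - fib ?m"] False zeckendorf_remove less.prems mem by simp
    then show ?thesis using mem by blast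
  qed
qed

lemma le_fib_Suc_Suc: "n \<le> fib (Suc (Suc n))"
proof (induction n)
  case (Suc n)
  have "0 < fib (Suc n)" by (simp add: fib_neq_0_nat)
  then show ?case using Suc by simp
qed simp

lemma zeckendorf_exists: "\<exists>S. is_zeckendorf S n"
proof (induction n rule: less_induct)
  case (less n)
  show ?case
  proof (cases "n = 0")
    case True
    then show ?thesis by (intro exI[of _ "{}"]) (simp add: is_zeckendorf_def)
  next
    case False
    define m where "m = (LEAST m. n < fib (Suc m))"
    have ex: "n < fib (Suc (Suc (Suc n)))"
      using le_fib_Suc_Suc[of "Suc n"] by linarith
    have m: "n < fib (Suc m)" unfolding m_def using ex by (rule LeastI)
    obtain k where k: "m = Suc (Suc k)"
    proof (cases m rule: fib.cases)
      case 1
      then show ?thesis using m False by simp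
    next
      case 2
      then show ?thesis using m False by simp
    qed
    have "\<not> n < fib (Suc (Suc k))"
      using not_less_Least[of "Suc k" "\<lambda>m. n < fib (Suc m)"] k m_def by auto
    then have le: "fib m \<le> n" by (simp add: k)
    have "0 < fib m" by (simp add: k fib_neq_0_nat)
    then obtain S where S: "is_zeckendorf S (n - fib m)"
      using less.IH[of "n - fib m"] le by auto
    have small: "i \<le> k" if "i \<in> S" for i
    proof (rule ccontr)
      assume "\<not> i \<le> k"
      then have "fib (Suc k) \<le> fib i" by (intro fib_mono) simp
      also have "\<dots> \<le> (\<Sum>i\<in>S. fib i)"
        using S that by (intro member_le_sum) (auto simp: is_zeckendorf_def)
      also have "\<dots> = n - fib m" using S by (simp add: is_zeckendorf_def)
      finally show False using m le k by simp
    qed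
    have "m \<notin> S" "Suc m \<notin> S" using small[of m] small[of "Suc m"] k by auto
    moreover have "Suc i \<noteq> m" if "i \<in> S" for i using small[OF that] k by auto
    ultimately have "is_zeckendorf (insert m S) n"
      using S le k by (auto simp: is_zeckendorf_def)
    then show ?thesis by blast
  qed
qed

theorem zeckendorf_ex1: "\<exists>!S. is_zeckendorf S n"
  using zeckendorf_exists zeckendorf_unique by blast

definition s_F :: "nat \<Rightarrow> nat" where
  "s_F n = card (THE S. is_zeckendorf S n)"

lemma s_F_eq: "is_zeckendorf S n \<Longrightarrow> s_F n = card S"
  unfolding s_F_def using zeckendorf_ex1 by (simp add: the1_equality)

lemma s_F_0: "s_F 0 = 0"
  using s_F_eq[of "{}" 0] by (simp add: is_zeckendorf_def)

(* csqrt is the principal root, so csqrt (-3) = \<i> * sqrt 3;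
   the real sqrt (-3) would denote - sqrt 3. *)
definition \<sigma> :: complex where
  "\<sigma> = (1 + csqrt (-3)) / 2"

(* c starts at index 1; the value at 0 is a dummy. *)
fun c :: "nat \<Rightarrow> complex" where
  "c 0 = 0"
| "c (Suc n) = (\<Sum>k=0..n. \<sigma> ^ s_F k * cnj \<sigma> ^ s_F (n - k))"

end

theory Submission
  imports Defs
begin

text \<open>Exchanging \<open>k\<close> and \<open>n - k\<close> conjugates each summand, so the sum is real. It also lies in
  the ring of Eisenstein integers, whose real elements are the integers.\<close>

lemma sigma_eq: "\<sigma> = Complex (1 / 2) (sqrt 3 / 2)"
  by (simp add: \<sigma>_def complex_eq_iff)

text \<open>\<open>\<sigma>\<close> is a primitive sixth root of unity, hence a root of x^2 - x + 1.
  This relation reduces every product back to degree one in \<open>\<sigma>\<close>.\<close>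

lemma sigma_square: "\<sigma> * \<sigma> = \<sigma> - 1"
  by (simp add: sigma_eq complex_eq_iff)

lemma cnj_sigma: "cnj \<sigma> = 1 - \<sigma>"
  by (simp add: sigma_eq complex_eq_iff)

text \<open>Explicit integer coordinates in the basis 1, \<open>\<sigma>\<close> let the imaginary
  part be read off from \<open>b\<close> alone.\<close>

definition eisenstein :: "complex set" where
  "eisenstein = {of_int a + of_int b * \<sigma> |a b. True}"

lemma eisensteinI: "z = of_int a + of_int b * \<sigma> \<Longrightarrow> z \<in> eisenstein"
  unfolding eisenstein_def by blast

lemma eisensteinE:
  assumes "z \<in> eisenstein"
  obtains a b where "z = of_int a + of_int b * \<sigma>"
  using assms unfolding eisenstein_def by blast

lemma eisenstein_0: "0 \<in> eisenstein"
  by (rule eisensteinI[of _ 0 0]) simp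

lemma eisenstein_1: "1 \<in> eisenstein"
  by (rule eisensteinI[of _ 1 0]) simp

lemma eisenstein_sigma: "\<sigma> \<in> eisenstein"
  by (rule eisensteinI[of _ 0 1]) simp

lemma eisenstein_cnj_sigma: "cnj \<sigma> \<in> eisenstein"
  by (rule eisensteinI[of _ 1 "-1"]) (simp add: cnj_sigma)

lemma eisenstein_add:
  assumes "x \<in> eisenstein" "y \<in> eisenstein"
  shows "x + y \<in> eisenstein"
proof -
  obtain a b d e where "x = of_int a + of_int b * \<sigma>" "y = of_int d + of_int e * \<sigma>"
    using assms by (metis eisensteinE)
  then show ?thesis
    by (intro eisensteinI[of _ "a + d" "b + e"]) (simp add: algebra_simps)
qed

lemma eisenstein_mult:
  assumes "x \<in> eisenstein" "y \<in> eisenstein"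
  shows "x * y \<in> eisenstein"
proof -
  obtain a b d e where xy: "x = of_int a + of_int b * \<sigma>" "y = of_int d + of_int e * \<sigma>"
    using assms by (metis eisensteinE)
  \<comment> \<open>The square is kept as a separate factor so that \<open>sigma_square\<close> can
    rewrite it.\<close>
  have "x * y = of_int (a * d) + of_int (a * e + b * d) * \<sigma> + of_int (b * e) * (\<sigma> * \<sigma>)"
    by (simp add: xy algebra_simps)
  also have "\<dots> = of_int (a * d - b * e) + of_int (a * e + b * d + b * e) * \<sigma>"
    by (simp add: sigma_square algebra_simps)
  finally show ?thesis by (rule eisensteinI)
qed

lemma eisenstein_power: "x \<in> eisenstein \<Longrightarrow> x ^ n \<in> eisenstein"
  by (induction n) (simp_all add: eisenstein_1 eisenstein_mult)

lemma eisenstein_sum: "(\<And>i. i \<in> A \<Longrightarrow> f i \<in> eisenstein) \<Longrightarrow> sum f A \<in> eisenstein"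
  \<comment> \<open>A sum over an infinite set is 0 by convention, so \<open>eisenstein_0\<close>
    covers that case.\<close>
  by (induction A rule: infinite_finite_induct) (simp_all add: eisenstein_0 eisenstein_add)

text \<open>The imaginary part of a + b\<open>\<sigma>\<close> is b * sqrt 3 / 2, so it vanishes
  only for b = 0, which leaves the integer a.\<close>

lemma eisenstein_real_imp_Ints:
  assumes "z \<in> eisenstein" "cnj z = z"
  shows "z \<in> \<int>"
proof -
  obtain a b where z: "z = of_int a + of_int b * \<sigma>"
    using assms(1) by (rule eisensteinE)
  have "Im z = 0"
    using assms(2) by (simp add: complex_eq_iff)
  then have "b = 0"
    by (simp add: z sigma_eq)
  then show ?thesis by (simp add: z)
qed

lemma cnj_c: "cnj (c n) = c n"
proof (cases n)
  case (Suc m)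
  have "cnj (c n) = (\<Sum>k=0..m. \<sigma> ^ s_F (m - k) * cnj \<sigma> ^ s_F k)"
    by (simp add: Suc mult.commute)
  also have "\<dots> = (\<Sum>k=0..m. \<sigma> ^ s_F k * cnj \<sigma> ^ s_F (m - k))"
    \<comment> \<open>Reversing the order of summation replaces \<open>k\<close> by
      \<open>m - k\<close>; since \<open>k \<le> m\<close>, the truncated difference
      \<open>m - (m - k)\<close> is \<open>k\<close>.\<close>
    by (subst sum.atLeastAtMost_rev) simp
  finally show ?thesis by (simp add: Suc)
qed simp

lemma c_eisenstein: "c n \<in> eisenstein"
  by (cases n) (simp_all add: eisenstein_0 eisenstein_sum eisenstein_mult eisenstein_power
      eisenstein_sigma eisenstein_cnj_sigma)

theorem mainTheorem4:
  fixes n :: nat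
  assumes "n \<ge> 1"
  shows "c n \<in> \<int>"
  using c_eisenstein cnj_c by (rule eisenstein_real_imp_Ints)

end
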